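(* Let $\mathcal{X}$ (sample space) and $\mathcal{Z}$ (noise space) be sets, let $m\ge 1$ be an integer, let $x_1,\dots,x_m\in\mathcal{X}$ and $z_1,\dots,z_m\in\mathcal{Z}$, let $\eta\in(0,1]$, and let $\mathcal{G}$ be a nonempty class of maps $G:\mathcal{Z}\to\mathcal{X}$ (generators). Fix a discriminator $D:\mathcal{X}\to(0,1)$. For $G\in\mathcal{G}$ and a weight vector $v=(v_1,\dots,v_m)$ let $$L(G,D;v)=\frac1m\sum_{i=1}^m\log(D(x_i))+\sum_{i=1}^m v_i\log\bigl(1-D(G(z_i))\bigr),$$ and let $w=w(G)$ be the weight vector with entries $$w_i(G)=\frac{\eta^{\,1-D(G(z_i))}}{\sum_{j=1}^m\eta^{\,1-D(G(z_j))}},\qquad i=1,\dots,m.$$ Let $G^*_{D;w}\in\mathcal{G}$ be an optimum generator for the weighted loss, i.e. a minimizer over $G\in\mathcal{G}$ of $G\mapsto L(G,D;w(G))$, and let $G^*_{D;\frac1m}\in\mathcal{G}$ be an optimum generator for the equally-weighted loss, i.e. a minimizer over $G\in\mathcal{G}$ of $G\mapsto L(G,D;\tfrac1m)$. Then $$L\bigl(G^*_{D;w},D;w(G^*_{D;w})\bigr)\le L\bigl(G^*_{D;\frac1m},D;\tfrac1m\bigr).$$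
   Context: In $L(G,D;\tfrac1m)$ the symbol $\tfrac1m$ denotes the uniform weight vector $(\tfrac1m,\dots,\tfrac1m)$ of length $m$. The points $x_i$ are real data samples and the points $z_i$ are noise samples; both are fixed. $D(x)$ is the discriminator's estimate of the probability that $x$ is a real sample, and $G(z)$ is the fake sample produced by the generator from the noise $z$. The two minimizers are assumed to exist. *)

theory Defs
  imports Complex_Main "HOL-Library.FuncSet"
begin

text \<open>
  Vectors and samples of length \<open>m\<close> are functions on \<open>nat\<close>, of which only the values at
  the indices \<open>1, \<dots>, m\<close> are used.
\<close>

definition gan_loss ::
  "nat \<Rightarrow> (nat \<Rightarrow> 'x) \<Rightarrow> (nat \<Rightarrow> 'z) \<Rightarrow> ('z \<Rightarrow> 'x) \<Rightarrow> ('x \<Rightarrow> real) \<Rightarrow> (nat \<Rightarrow> real) \<Rightarrow> real"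
  where "gan_loss m x z G D v =
    1 / real m * (\<Sum>i=1..m. ln (D (x i))) + (\<Sum>i=1..m. v i * ln (1 - D (G (z i))))"

definition gan_weight ::
  "real \<Rightarrow> nat \<Rightarrow> (nat \<Rightarrow> 'z) \<Rightarrow> ('x \<Rightarrow> real) \<Rightarrow> ('z \<Rightarrow> 'x) \<Rightarrow> nat \<Rightarrow> real"
  where "gan_weight \<eta> m z D G i =
    \<eta> powr (1 - D (G (z i))) / (\<Sum>j=1..m. \<eta> powr (1 - D (G (z j))))"

definition uniform_weight :: "nat \<Rightarrow> nat \<Rightarrow> real"
  where "uniform_weight m i = 1 / real m"

end

theory Submission
  imports Defs
begin

text \<open>
  Both \<open>\<eta> powr t\<close> and \<open>ln t\<close> are monotone in \<open>t = 1 - D (G (z i))\<close>, the first decreasing and the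
  second increasing, so by Chebyshev's sum inequality the weights \<open>w(G)\<close> give a loss at most that of
  the uniform weights, for each single \<open>G\<close>. Apply this at the minimizer of the uniform loss, and use
  that the minimizer of the weighted loss does at least as well there.
\<close>

text \<open>Summed over all pairs, the hypothesis gives a nonpositive double sum, which expands to
  twice the difference of the two sides.\<close>

lemma Chebyshev_sum_oppositely_ordered:
  fixes a b :: "'i \<Rightarrow> real"
  assumes "\<And>i j. i \<in> I \<Longrightarrow> j \<in> I \<Longrightarrow> (a i - a j) * (b i - b j) \<le> 0"
  shows "real (card I) * (\<Sum>i\<in>I. a i * b i) \<le> (\<Sum>i\<in>I. a i) * (\<Sum>i\<in>I. b i)"
proof -
  have "(\<Sum>i\<in>I. \<Sum>j\<in>I. (a i - a j) * (b i - b j)) \<le> 0"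
    by (intro sum_nonpos assms)
  also have "(\<Sum>i\<in>I. \<Sum>j\<in>I. (a i - a j) * (b i - b j)) =
      2 * (real (card I) * (\<Sum>i\<in>I. a i * b i)) - (\<Sum>i\<in>I. \<Sum>j\<in>I. a i * b j) - (\<Sum>i\<in>I. \<Sum>j\<in>I. a j * b i)"
    by (simp add: algebra_simps sum.distrib sum_subtractf sum_distrib_left)
  \<comment> \<open>The two mixed sums agree up to exchanging indices; each is the product of the
    single sums.\<close>
  also have "(\<Sum>i\<in>I. \<Sum>j\<in>I. a j * b i) = (\<Sum>i\<in>I. \<Sum>j\<in>I. a i * b j)"
    by (rule sum.swap)
  finally show ?thesis
    by (simp add: sum_product)
qed

lemma gan_loss_weight_le_uniform:
  assumes "m \<ge> 1" "0 < \<eta>" "\<eta> \<le> 1"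
    and D: "\<And>i. i \<in> {1..m} \<Longrightarrow> D (G (z i)) < 1"
  shows "gan_loss m x z G D (gan_weight \<eta> m z D G) \<le> gan_loss m x z G D (uniform_weight m)"
proof -
  define a where "a i = \<eta> powr (1 - D (G (z i)))" for i
  define b where "b i = ln (1 - D (G (z i)))" for i
  have "(a i - a j) * (b i - b j) \<le> 0" if ij: "i \<in> {1..m}" "j \<in> {1..m}" for i j
  \<comment> \<open>A larger \<open>D\<close> value gives a larger \<open>a\<close>, as
    \<open>\<eta> \<le> 1\<close>, and a smaller \<open>b\<close>, as \<open>D < 1\<close> keeps the
    arguments of \<open>ln\<close> positive.\<close>
  proof (cases "D (G (z i)) \<le> D (G (z j))")
    case True
    then have "a i \<le> a j" "b j \<le> b i"
      using assms ij by (auto simp: a_def b_def intro!: powr_mono')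
    then show ?thesis by (simp add: mult_nonpos_nonneg)
  next
    case False
    then have "a j \<le> a i" "b i \<le> b j"
      using assms ij by (auto simp: a_def b_def intro!: powr_mono')
    then show ?thesis by (simp add: mult_nonneg_nonpos)
  qed
  then have "real m * (\<Sum>i=1..m. a i * b i) \<le> (\<Sum>i=1..m. a i) * (\<Sum>i=1..m. b i)"
    using Chebyshev_sum_oppositely_ordered[of "{1..m}" a b] by simp
  \<comment> \<open>This sum normalizes the weights. Dividing by it and by \<open>m\<close> compares
    the fake-sample terms of the two losses; the real-sample terms coincide.\<close>
  moreover have "0 < (\<Sum>i=1..m. a i)"
    using assms by (intro sum_pos) (auto simp: a_def)
  ultimately have "(\<Sum>i=1..m. a i * b i) / (\<Sum>i=1..m. a i) \<le> (\<Sum>i=1..m. b i) / real m"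
    using \<open>m \<ge> 1\<close> by (simp add: field_simps)
  then show ?thesis
    by (simp add: gan_loss_def gan_weight_def uniform_weight_def a_def b_def sum_divide_distrib)
qed

theorem theorem1:
  fixes X :: "'x set" and Z :: "'z set" and m :: nat
    and x :: "nat \<Rightarrow> 'x" and z :: "nat \<Rightarrow> 'z" and \<eta> :: real
    and \<G> :: "('z \<Rightarrow> 'x) set" and D :: "'x \<Rightarrow> real" and Gw Gu :: "'z \<Rightarrow> 'x"
  assumes "m \<ge> 1"
    and "x \<in> {1..m} \<rightarrow> X"
    and "z \<in> {1..m} \<rightarrow> Z"
    and "0 < \<eta>" and "\<eta> \<le> 1"
    and "\<G> \<noteq> {}" and "\<G> \<subseteq> Z \<rightarrow> X"
    and "D \<in> X \<rightarrow> {0<..<1}"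
    and "is_arg_min (\<lambda>G. gan_loss m x z G D (gan_weight \<eta> m z D G)) (\<lambda>G. G \<in> \<G>) Gw"
    and "is_arg_min (\<lambda>G. gan_loss m x z G D (uniform_weight m)) (\<lambda>G. G \<in> \<G>) Gu"
  shows "gan_loss m x z Gw D (gan_weight \<eta> m z D Gw) \<le> gan_loss m x z Gu D (uniform_weight m)"
proof -
  have "Gu \<in> \<G>" using assms(10) by (simp add: is_arg_min_def)
  \<comment> \<open>The bound on \<open>D\<close> is known only on \<open>X\<close>, and
    \<open>Gu\<close> sends the noise points there.\<close>
  then have "D (Gu (z i)) < 1" if "i \<in> {1..m}" for i
    using assms(3,7,8) that by (fastforce simp: Pi_iff)
  then have "gan_loss m x z Gu D (gan_weight \<eta> m z D Gu) \<le> gan_loss m x z Gu D (uniform_weight m)"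
    using assms(1,4,5) by (intro gan_loss_weight_le_uniform)
  moreover have "gan_loss m x z Gw D (gan_weight \<eta> m z D Gw) \<le> gan_loss m x z Gu D (gan_weight \<eta> m z D Gu)"
    using assms(9) \<open>Gu \<in> \<G>\<close> by (simp add: is_arg_min_linorder)
  ultimately show ?thesis by linarith
qed

end
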